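(* Let $G$ be a transitive permutation group on a finite set $\Omega$, and suppose that the action of $G$ on $\Omega$ is binary. Let $p$ be a prime and let $\mathcal{C}$ be a conjugacy class of $G$ consisting of elements of order $p$ of maximal fixity. Let $H$ be the stabilizer in $G$ of a point of $\Omega$ and let $g \in H \cap \mathcal{C}$. Then $H$ contains all vertices in the connected component of $\Gamma(\mathcal{C})$ that contains $g$.
   Context: All groups and sets are finite; groups act on the right. Binary: for $I=(I_1,\dots,I_n)$, $J=(J_1,\dots,J_n)\in\Omega^n$ and $r\le n$, say $I$ and $J$ are $r$-related if for every choice of indices $1\le k_1<\dots<k_r\le n$ there is $g\in G$ with $I_{k_i}^g=J_{k_i}$ for all $i$. The relational complexity $\mathrm{RC}(G,\Omega)$ is the smallest integer $k\ge 2$ such that, for all $n\ge k$ and all $I,J\in\Omega^n$, if $I$ and $J$ are $k$-related then they are $n$-related (i.e. $I^g=J$ for some $g\in G$). The action is binary if $\mathrm{RC}(G,\Omega)=2$. An element of order $p$ of maximal fixity is an element of $G$ of order $p$ that fixes at least as many points of $\Omega$ as any other element of $G$ of order $p$. For a conjugacy class $\mathcal{C}$ of $G$, $\Gamma(\mathcal{C})$ is the graph whose vertices are the elements of $\mathcal{C}$, two vertices $g,h\in\mathcal{C}$ being joined by an edge if $g$ and $h$ commute and either $gh^{-1}\in\mathcal{C}$ or $hg^{-1}\in\mathcal{C}$. *)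

theory Defs
  imports
    "HOL-Computational_Algebra.Primes"
    "HOL-Algebra.Group_Action"
    "HOL-Algebra.Multiplicative_Group"
    "Graph_Theory.Digraph_Component"
begin

text \<open>
  A permutation group on \<open>\<Omega>\<close> is a faithful action \<open>\<phi>\<close> of a group \<open>G\<close> on \<open>\<Omega>\<close>.
  HOL-Algebra acts on the left; a right action corresponds to the left action
  \<open>\<phi> g \<omega> = \<omega>\<close> moved by the inverse of \<open>g\<close>.  The group \<open>G\<close> itself is the same for both, and so
  are stabilizers, fixed points and the relation below, since \<open>g\<close> ranges over all of \<open>G\<close>.
\<close>

text \<open>
  Tuples are lists, indexed from \<open>0\<close>.  A choice of indices \<open>k\<^sub>1 < \<dots> < k\<^sub>r\<close> is the
  \<open>r\<close>-element set \<open>S\<close> of these indices.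
\<close>

definition related ::
  "('g, 'm) monoid_scheme \<Rightarrow> ('g \<Rightarrow> 'a \<Rightarrow> 'a) \<Rightarrow> nat \<Rightarrow> 'a list \<Rightarrow> 'a list \<Rightarrow> bool" where
  "related G \<phi> r I J \<longleftrightarrow>
     length I = length J \<and> r \<le> length I \<and>
     (\<forall>S. S \<subseteq> {..<length I} \<and> card S = r \<longrightarrow>
        (\<exists>g\<in>carrier G. \<forall>i\<in>S. \<phi> g (I ! i) = J ! i))"

definition complexity_bound ::
  "('g, 'm) monoid_scheme \<Rightarrow> 'a set \<Rightarrow> ('g \<Rightarrow> 'a \<Rightarrow> 'a) \<Rightarrow> nat \<Rightarrow> bool" where
  "complexity_bound G \<Omega> \<phi> k \<longleftrightarrow>
     (\<forall>n\<ge>k. \<forall>I J. set I \<subseteq> \<Omega> \<and> set J \<subseteq> \<Omega> \<and> length I = n \<and> length J = n \<and>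
        related G \<phi> k I J \<longrightarrow> related G \<phi> n I J)"

definition relational_complexity ::
  "('g, 'm) monoid_scheme \<Rightarrow> 'a set \<Rightarrow> ('g \<Rightarrow> 'a \<Rightarrow> 'a) \<Rightarrow> nat" where
  "relational_complexity G \<Omega> \<phi> = (LEAST k. 2 \<le> k \<and> complexity_bound G \<Omega> \<phi> k)"

text \<open>For finite \<open>\<Omega>\<close> the minimum above is attained.\<close>

lemma complexity_bound_exists:
  assumes fin: "finite \<Omega>"
  shows "complexity_bound G \<Omega> \<phi> (card \<Omega> + 2)"
  unfolding complexity_bound_def
proof (intro allI impI, elim conjE)
  fix n I J
  assume n: "card \<Omega> + 2 \<le> n" and I: "set I \<subseteq> \<Omega>" and J: "set J \<subseteq> \<Omega>"
    and lI: "length I = n" and lJ: "length J = n" and rel: "related G \<phi> (card \<Omega> + 2) I J"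
  have ext: "\<exists>g\<in>carrier G. \<forall>i\<in>T. \<phi> g (I ! i) = J ! i"
    if T: "T \<subseteq> {..<n}" "card T \<le> card \<Omega> + 2" for T
  proof -
    obtain S where "T \<subseteq> S" "S \<subseteq> {..<n}" "card S = card \<Omega> + 2"
      using exists_subset_between[of T "card \<Omega> + 2" "{..<n}"] T n by auto
    then show ?thesis
      using rel lI unfolding related_def by blast
  qed
  obtain T where T: "T \<subseteq> {..<n}" "inj_on ((!) I) T" "(!) I ` T = (!) I ` {..<n}"
    by (metis subset_image_inj order_refl)
  have "(!) I ` T \<subseteq> \<Omega>"
    using T(1) I lI by (auto simp: subset_iff)
  then have cT: "card T \<le> card \<Omega>"
    using card_image[OF T(2)] card_mono[OF fin] by metis
  obtain g where g: "g \<in> carrier G" "\<forall>i\<in>T. \<phi> g (I ! i) = J ! i"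
    using ext[OF T(1)] cT by auto
  have "\<phi> g (I ! i) = J ! i" if i: "i < n" for i
  proof -
    obtain t where t: "t \<in> T" "I ! t = I ! i"
      using T(3) i by (metis imageE imageI lessThan_iff)
    obtain h where "\<phi> h (I ! i) = J ! i" "\<phi> h (I ! t) = J ! t"
      using ext[of "{i, t}"] i t(1) T(1) card_2_iff'[of "{i, t}"]
      by (cases "i = t") auto
    then show ?thesis
      using g(2) t by metis
  qed
  then show "related G \<phi> n I J"
    unfolding related_def using g(1) lI lJ by (auto intro!: bexI[of _ g])
qed

definition binary_action ::
  "('g, 'm) monoid_scheme \<Rightarrow> 'a set \<Rightarrow> ('g \<Rightarrow> 'a \<Rightarrow> 'a) \<Rightarrow> bool" where
  "binary_action G \<Omega> \<phi> \<longleftrightarrow> relational_complexity G \<Omega> \<phi> = 2"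

definition max_fixity ::
  "('g, 'm) monoid_scheme \<Rightarrow> 'a set \<Rightarrow> ('g \<Rightarrow> 'a \<Rightarrow> 'a) \<Rightarrow> nat \<Rightarrow> 'g \<Rightarrow> bool" where
  "max_fixity G \<Omega> \<phi> p x \<longleftrightarrow>
     x \<in> carrier G \<and> group.ord G x = p \<and>
     (\<forall>y\<in>carrier G. group.ord G y = p \<longrightarrow>
        card (invariants \<Omega> \<phi> y) \<le> card (invariants \<Omega> \<phi> x))"

definition conjugacy_classes :: "('g, 'm) monoid_scheme \<Rightarrow> 'g set set" where
  "conjugacy_classes G =
     orbits G (carrier G) (\<lambda>g. \<lambda>h\<in>carrier G. g \<otimes>\<^bsub>G\<^esub> h \<otimes>\<^bsub>G\<^esub> inv\<^bsub>G\<^esub> g)"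

definition class_graph :: "('g, 'm) monoid_scheme \<Rightarrow> 'g set \<Rightarrow> ('g, 'g \<times> 'g) pre_digraph" where
  "class_graph G C =
     \<lparr>verts = C,
      arcs = {(g, h). g \<in> C \<and> h \<in> C \<and> g \<noteq> h \<and> g \<otimes>\<^bsub>G\<^esub> h = h \<otimes>\<^bsub>G\<^esub> g \<and>
                (g \<otimes>\<^bsub>G\<^esub> inv\<^bsub>G\<^esub> h \<in> C \<or> h \<otimes>\<^bsub>G\<^esub> inv\<^bsub>G\<^esub> g \<in> C)},
      tail = fst, head = snd\<rparr>"

text \<open>
  An undirected simple graph is a loop-free symmetric digraph without parallel arcs; in such a
  graph the strong component \<open>scc_of\<close> of a vertex is its connected component.
\<close>

lemma graph_class_graph:
  assumes "finite C"
  shows "graph (class_graph G C)"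
proof -
  have "arcs (class_graph G C) \<subseteq> C \<times> C"
    by (auto simp: class_graph_def)
  then have "finite (arcs (class_graph G C))"
    using assms by (meson finite_SigmaI finite_subset)
  then show ?thesis
    using assms
    by unfold_locales (auto simp: class_graph_def arc_to_ends_def symmetric_conv)
qed

end

theory Submission
  imports Defs
begin

text \<open>
  Adjacent vertices of the graph have the same fixed points; hence whether a vertex fixes a given
  point is constant along paths, which is the claim.

  Let \<open>g\<close> and \<open>h\<close> commute and let \<open>g\<close>, \<open>h\<close> and \<open>z = g h\<inverse>\<close> have order \<open>p\<close> and maximal fixity,
  so that their fixed point sets \<open>F(g)\<close>, \<open>F(h)\<close>, \<open>F(z)\<close> have the same size.  Let \<open>\<tau>\<close> be the
  identity on \<open>F(g) \<union> F(z)\<close> and act as \<open>g\<close> on \<open>F(h)\<close>.  This is consistent, because a point fixed by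
  \<open>h\<close> and \<open>z\<close> is fixed by \<open>g\<close>.  On any two points \<open>\<tau>\<close> agrees with one of the elements \<open>1\<close>, \<open>g\<close>,
  \<open>z\<close>: the map \<open>\<tau>\<close> is \<open>1\<close> on \<open>F(g) \<union> F(z)\<close>, \<open>g\<close> on \<open>F(g) \<union> F(h)\<close>, and \<open>z\<close> on \<open>F(z) \<union> F(h)\<close>, since
  \<open>z\<close> and \<open>g\<close> agree on the fixed points of \<open>h\<close>.  As the action is binary, some group
  element \<open>x\<close> agrees with \<open>\<tau>\<close> on all three sets (lemma \<open>binary_action_extension\<close>).

  If \<open>g\<close> acts trivially on \<open>F(h)\<close>, then \<open>F(h) \<subseteq> F(g)\<close> and the sizes give equality.  Otherwise \<open>x\<close>
  acts on the \<open>g\<close>-invariant set \<open>F(h)\<close> as the permutation \<open>g\<close> of order \<open>p\<close>, so \<open>p\<close> divides the order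
  of \<open>x\<close> (lemma \<open>prime_dvd_ord_if_agree\<close>), and a power of \<open>x\<close> is an element of order \<open>p\<close> that fixes
  \<open>F(g) \<union> F(z)\<close>.  Maximality of the fixity of \<open>g\<close> forces \<open>F(z) = F(g)\<close>, and then \<open>h = z\<inverse> g\<close>
  fixes \<open>F(g)\<close>.
\<close>

text \<open>
  Since the relational complexity is a minimum, it can be exploited only because some bound exists
  at all, which finiteness of \<open>\<Omega>\<close> guarantees.
\<close>

lemma binary_action_complexity_bound:
  assumes "finite \<Omega>" and "binary_action G \<Omega> \<phi>"
  shows "complexity_bound G \<Omega> \<phi> 2"
proof -
  have "2 \<le> card \<Omega> + 2 \<and> complexity_bound G \<Omega> \<phi> (card \<Omega> + 2)"
    using complexity_bound_exists[OF assms(1)] by simp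
  from LeastI[of "\<lambda>k. 2 \<le> k \<and> complexity_bound G \<Omega> \<phi> k", OF this]
  show ?thesis
    using assms(2) by (simp add: binary_action_def relational_complexity_def)
qed

text \<open>
  The form in which binarity is used: a map that is induced by group elements on all pairs of points
  is induced by a single group element.
\<close>

lemma binary_action_extension:
  assumes fin: "finite \<Omega>" and binary: "binary_action G \<Omega> \<phi>"
    and A: "A \<subseteq> \<Omega>" "A \<noteq> {}" and \<tau>: "\<tau> ` A \<subseteq> \<Omega>"
    and pairs: "\<And>a b. a \<in> A \<Longrightarrow> b \<in> A \<Longrightarrow> \<exists>g\<in>carrier G. \<phi> g a = \<tau> a \<and> \<phi> g b = \<tau> b"
  shows "\<exists>x\<in>carrier G. \<forall>a\<in>A. \<phi> x a = \<tau> a"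
proof -
  obtain xs where xs: "set xs = A"
    using A(1) fin by (metis finite_list finite_subset)
  \<comment> \<open>The entries are repeated so that the tuple has length at least \<open>2\<close> even if \<open>A\<close> is a point.\<close>
  define I where "I = xs @ xs"
  define J where "J = map \<tau> I"
  have I: "set I = A" and lJ: "length J = length I"
    by (auto simp: I_def J_def xs)
  have len: "2 \<le> length I"
    using A(2) xs by (cases xs) (auto simp: I_def)
  have "\<exists>g\<in>carrier G. \<forall>i\<in>S. \<phi> g (I ! i) = J ! i"
    if S: "S \<subseteq> {..<length I}" "card S = 2" for S
  proof -
    obtain i j where ij: "S = {i, j}"
      using S(2) by (auto simp: card_2_iff)
    then have "I ! i \<in> A" "I ! j \<in> A" "i < length I" "j < length I"
      using S(1) I by auto
    then show ?thesis
      using pairs[of "I ! i" "I ! j"] by (auto simp: ij J_def)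
  qed
  then have "related G \<phi> 2 I J"
    using len lJ by (auto simp: related_def)
  moreover have "set J \<subseteq> \<Omega>"
    using \<tau> I by (auto simp: J_def)
  ultimately have "related G \<phi> (length I) I J"
    using binary_action_complexity_bound[OF fin binary] len lJ I A(1)
    unfolding complexity_bound_def by blast
  then obtain x where x: "x \<in> carrier G" "\<forall>i<length I. \<phi> x (I ! i) = J ! i"
    unfolding related_def by (metis card_lessThan lessThan_iff order_refl)
  then have "\<phi> x a = \<tau> a" if "a \<in> A" for a
    using that I by (auto simp: J_def in_set_conv_nth)
  then show ?thesis
    using x(1) by blast
qed

context group_action
begin

sublocale group G
  using group_hom group_hom.axioms(1) by blast

lemma one_fixes: "a \<in> E \<Longrightarrow> \<phi> \<one> a = a"
  using id_eq_one by (metis restrict_apply')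

lemma pow_agree:
  fixes n :: nat
  assumes g: "g \<in> carrier G" and x: "x \<in> carrier G"
    and B: "B \<subseteq> E" "\<phi> g ` B \<subseteq> B"
    and agree: "\<And>b. b \<in> B \<Longrightarrow> \<phi> x b = \<phi> g b" and "b \<in> B"
  shows "\<phi> (x [^] n) b = \<phi> (g [^] n) b"
  using \<open>b \<in> B\<close>
proof (induction n arbitrary: b)
  case 0
  then show ?case by simp
next
  case (Suc n)
  then have "\<phi> g b \<in> B" "b \<in> E"
    using B by auto
  then show ?case
    using Suc g x agree by (simp add: composition_rule)
qed

lemma pow_fixes:
  fixes n :: nat
  assumes "x \<in> carrier G" "a \<in> E" "\<phi> x a = a"
  shows "\<phi> (x [^] n) a = a"
  using assms by (induction n) (simp_all add: one_fixes composition_rule)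

text \<open>
  If \<open>p\<close> did not divide \<open>m = ord x\<close>, then \<open>g\<close> would be a power of \<open>g\<^sup>m\<close>, which acts on \<open>B\<close> as
  \<open>x\<^sup>m = 1\<close>.
\<close>

lemma prime_dvd_ord_if_agree:
  assumes p: "prime p" and g: "g \<in> carrier G" "ord g = p" and x: "x \<in> carrier G"
    and B: "B \<subseteq> E" "\<phi> g ` B \<subseteq> B"
    and agree: "\<And>b. b \<in> B \<Longrightarrow> \<phi> x b = \<phi> g b"
    and b: "b \<in> B" "\<phi> g b \<noteq> b"
  shows "p dvd ord x"
proof (rule ccontr)
  assume "\<not> p dvd ord x"
  then have "coprime (ord x) p"
    using p by (metis coprime_commute prime_imp_coprime_nat)
  then obtain k l where kl: "ord x * k = p * l + 1"
    using coprime_bezout_strong[of "ord x" p] p by (metis not_prime_1)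
  have "g [^] (p * l) = \<one>"
    using g by (simp add: pow_eq_id)
  then have "g [^] (ord x * k) = g"
    using g(1) by (simp add: kl)
  moreover have "x [^] (ord x * k) = \<one>"
    using x by (simp add: pow_eq_id)
  ultimately have "\<phi> g b = \<phi> \<one> b"
    using pow_agree[OF g(1) x B agree b(1)] by metis
  then show False
    using b B(1) one_fixes by auto
qed

text \<open>
  The quotient \<open>z = g h\<inverse>\<close> enters twice: it agrees with \<open>\<tau>\<close> on pairs taken from \<open>F(z)\<close> and \<open>F(h)\<close>,
  where \<open>1\<close> and \<open>g\<close> in general do not, and its maximal fixity yields \<open>F(z) = F(g)\<close> rather than just
  \<open>F(z) \<subseteq> F(g)\<close>, so that the points fixed by \<open>g\<close> are fixed by \<open>h\<close>.
\<close>

lemma invariants_eq_if_quotient_max_fixity: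
  assumes finG: "finite (carrier G)" and finE: "finite E"
    and binary: "binary_action G E \<phi>" and p: "prime p"
    and mg: "max_fixity G E \<phi> p g" and mh: "max_fixity G E \<phi> p h"
    and mz: "max_fixity G E \<phi> p (g \<otimes> inv h)"
    and comm: "g \<otimes> h = h \<otimes> g"
  shows "invariants E \<phi> g = invariants E \<phi> h"
proof -
  define z where "z = g \<otimes> inv h"
  define F where "F = invariants E \<phi>"
  have F_iff: "a \<in> F y \<longleftrightarrow> a \<in> E \<and> \<phi> y a = a" for a y
    by (simp add: F_def invariants_def)
  have finF: "finite (F y)" for y
    using finE by (simp add: F_def invariants_def)
  have g: "g \<in> carrier G" "ord g = p" and h: "h \<in> carrier G" "ord h = p"
    and z: "z \<in> carrier G" "ord z = p"
    using mg mh mz by (auto simp: max_fixity_def z_def)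
  have max: "card (F y) \<le> card (F g)" if "y \<in> carrier G" "ord y = p" for y
    using mg that by (auto simp: max_fixity_def F_def)
  have card_h: "card (F h) = card (F g)" and card_z: "card (F z) = card (F g)"
    using mg mh mz by (auto simp: max_fixity_def F_def z_def intro!: le_antisym)
  have zh: "z \<otimes> h = g"
    using g h by (simp add: z_def m_assoc)
  have z_on: "\<phi> z a = \<phi> g a" if "a \<in> F h" for a
    using that composition_rule[of a z h] z(1) h(1) by (simp add: F_iff zh)
  have g_on: "\<phi> g a \<in> F h" if "a \<in> F h" for a
  proof -
    have a: "a \<in> E" "\<phi> h a = a"
      using that by (auto simp: F_iff)
    have "\<phi> h (\<phi> g a) = \<phi> (g \<otimes> h) a"
      using a(1) g(1) h(1) by (simp add: composition_rule comm)
    also have "\<dots> = \<phi> g a"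
      using a g(1) h(1) by (simp add: composition_rule)
    finally show ?thesis
      using a(1) g(1) element_image by (auto simp: F_iff)
  qed
  have "F g = F h"
  proof (cases "F h \<subseteq> F g")
    case True
    then show ?thesis
      using card_subset_eq[OF finF True] card_h by simp
  next
    case False
    then obtain b where b: "b \<in> F h" "\<phi> g b \<noteq> b"
      using F_iff by blast
    define A where "A = F g \<union> F z \<union> F h"
    define \<tau> where "\<tau> = (\<lambda>a. if a \<in> F h then \<phi> g a else a)"
    have \<tau>_1: "\<phi> \<one> a = \<tau> a" if "a \<in> F g \<union> F z" for a
      using that one_fixes z_on by (auto simp: \<tau>_def F_iff)
    have \<tau>_g: "\<phi> g a = \<tau> a" if "a \<in> F g \<union> F h" for a
      using that by (auto simp: \<tau>_def F_iff)
    have \<tau>_z: "\<phi> z a = \<tau> a" if "a \<in> F z \<union> F h" for a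
      using that z_on by (auto simp: \<tau>_def F_iff)
    have "\<exists>x\<in>carrier G. \<forall>a\<in>A. \<phi> x a = \<tau> a"
    proof (rule binary_action_extension[OF finE binary])
      show "A \<subseteq> E" "A \<noteq> {}"
        using b(1) by (auto simp: A_def F_iff)
      show "\<tau> ` A \<subseteq> E"
        using g_on by (auto simp: A_def \<tau>_def F_iff)
    next
      fix a c assume "a \<in> A" "c \<in> A"
      \<comment> \<open>Any two of the three sets lie in one of the unions on which \<open>\<tau>\<close> is \<open>1\<close>, \<open>g\<close> or \<open>z\<close>.\<close>
      then consider "a \<in> F g \<union> F z" "c \<in> F g \<union> F z" | "a \<in> F g \<union> F h" "c \<in> F g \<union> F h"
        | "a \<in> F z \<union> F h" "c \<in> F z \<union> F h"
        unfolding A_def by blast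
      then show "\<exists>y\<in>carrier G. \<phi> y a = \<tau> a \<and> \<phi> y c = \<tau> c"
        using \<tau>_1 \<tau>_g \<tau>_z g(1) z(1) one_closed by cases blast+
    qed
    then obtain x where x: "x \<in> carrier G" "\<And>a. a \<in> A \<Longrightarrow> \<phi> x a = \<tau> a"
      by blast
    have "p dvd ord x"
    proof (rule prime_dvd_ord_if_agree[OF p g x(1), of "F h" b])
      show "F h \<subseteq> E" "\<phi> g ` F h \<subseteq> F h"
        using g_on by (auto simp: F_iff)
      show "\<phi> x c = \<phi> g c" if "c \<in> F h" for c
        using that x(2) by (simp add: A_def \<tau>_def)
    qed (use b in auto)
    then obtain m where m: "ord x = p * m"
      by blast
    have ordx: "ord x \<noteq> 0"
      using ord_ge_1[OF finG x(1)] by simp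
    define y where "y = x [^] m"
    have y: "y \<in> carrier G" "ord y = p"
      using ord_pow[OF x(1), of m] x(1) m ordx by (auto simp: y_def)
    have sub: "F g \<union> F z \<subseteq> F y"
    proof
      fix a assume a: "a \<in> F g \<union> F z"
      then have "a \<in> E"
        by (auto simp: F_iff)
      moreover have "\<phi> x a = a"
        using x(2)[of a] a \<tau>_1[OF a] one_fixes[OF \<open>a \<in> E\<close>] by (auto simp: A_def)
      ultimately show "a \<in> F y"
        using pow_fixes[OF x(1)] by (simp add: F_iff y_def)
    qed
    \<comment> \<open>Both \<open>F g\<close> and \<open>F z\<close> already have the largest size that \<open>F y\<close> can have.\<close>
    have "F g = F y"
      using sub max[OF y] by (intro card_seteq finF) auto
    moreover have "F z = F y"
      using sub max[OF y] card_z by (intro card_seteq finF) auto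
    ultimately have gz: "F g = F z"
      by simp
    have "F g \<subseteq> F h"
    proof
      fix a assume a: "a \<in> F g"
      have hz: "h \<otimes> z = g"
        using g(1) h(1) comm by (metis inv_closed m_assoc r_inv r_one z_def)
      have "a \<in> E" "\<phi> z a = a" "\<phi> g a = a"
        using a gz by (auto simp: F_iff)
      then show "a \<in> F h"
        using composition_rule[of a h z] h(1) z(1) by (simp add: F_iff hz)
    qed
    then show ?thesis
      using card_subset_eq[OF finF] card_h by simp
  qed
  then show ?thesis
    by (simp add: F_def)
qed

end

theorem lemma1p1:
  fixes G :: "('g, 'm) monoid_scheme"
    and \<Omega> :: "'a set"
    and \<phi> :: "'g \<Rightarrow> 'a \<Rightarrow> 'a"
    and p :: nat
    and C H :: "'g set"
    and \<omega> :: 'a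
    and g :: 'g
  assumes "finite (carrier G)" and "finite \<Omega>"
    and "faithful_action G \<Omega> \<phi>"
    and "transitive_action G \<Omega> \<phi>"
    and "binary_action G \<Omega> \<phi>"
    and "prime p"
    and "C \<in> conjugacy_classes G"
    and "\<And>x. x \<in> C \<Longrightarrow> max_fixity G \<Omega> \<phi> p x"
    and "\<omega> \<in> \<Omega>"
    and "H = stabilizer G \<phi> \<omega>"
    and "g \<in> H \<inter> C"
  shows "pre_digraph.scc_of (class_graph G C) g \<subseteq> H"
proof
  interpret group_action G \<Omega> \<phi>
    using assms(4) by (rule transitive_action.axioms(1))
  note eq = invariants_eq_if_quotient_max_fixity[OF assms(1,2,5,6) assms(8,8,8)]
  have step: "invariants \<Omega> \<phi> u = invariants \<Omega> \<phi> v"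
    if "(u, v) \<in> arcs_ends (class_graph G C)" for u v
  proof -
    have uv: "u \<in> C" "v \<in> C" "u \<otimes>\<^bsub>G\<^esub> v = v \<otimes>\<^bsub>G\<^esub> u"
      and "u \<otimes>\<^bsub>G\<^esub> inv\<^bsub>G\<^esub> v \<in> C \<or> v \<otimes>\<^bsub>G\<^esub> inv\<^bsub>G\<^esub> u \<in> C"
      using that by (auto simp: class_graph_def arcs_ends_def arc_to_ends_def)
    then show ?thesis
      using eq[of u v] eq[of v u] by auto
  qed
  fix v assume "v \<in> pre_digraph.scc_of (class_graph G C) g"
  then have "(g, v) \<in> rtrancl_on C (arcs_ends (class_graph G C))"
    by (simp add: pre_digraph.scc_of_def reachable_def class_graph_def)
  then have "v \<in> C \<and> invariants \<Omega> \<phi> v = invariants \<Omega> \<phi> g"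
    by (induction rule: rtrancl_on_induct) (use assms(11) step in auto)
  moreover have "\<omega> \<in> invariants \<Omega> \<phi> g"
    using assms(9-11) by (auto simp: invariants_def stabilizer_def)
  ultimately show "v \<in> H"
    using assms(8)[of v] assms(10) by (auto simp: invariants_def stabilizer_def max_fixity_def)
qed

end
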